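(* Let $\mathbb{F}$ be an arbitrary field with characteristic $2$, let $n$ be a positive integer, and let $A \in \mathrm{M}_n(\mathbb{F})$ be a square matrix whose trace belongs to $\{0,1\}$. Then the block-diagonal matrix $A\oplus 0_n$ is the sum of three idempotent matrices of $\mathrm{M}_{2n}(\mathbb{F})$.
   Context: $\mathrm{M}_n(\mathbb{F})$ denotes the algebra of all $n \times n$ matrices with entries in $\mathbb{F}$. A square matrix $P$ is idempotent if $P^2=P$. $A \oplus 0_n$ denotes the block-diagonal matrix $\begin{bmatrix} A & 0 \\ 0 & 0_n\end{bmatrix}$, where $0_n$ is the $n\times n$ zero matrix. *)

theory Defs
  imports "Jordan_Normal_Form.Matrix"
begin

definition trace_mat :: "'a::semiring_0 mat \<Rightarrow> 'a" where
  "trace_mat A = (\<Sum>i<dim_row A. A $$ (i, i))"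

definition idempotent_mat :: "'a::semiring_0 mat \<Rightarrow> bool" where
  "idempotent_mat P \<longleftrightarrow> square_mat P \<and> P * P = P"

end

theory Submission
  imports Defs "HOL-Library.Function_Algebras" "Jordan_Normal_Form.Jordan_Normal_Form_Existence"
    "Jordan_Normal_Form.DL_Rank"
begin

text \<open>In characteristic 2, a matrix \<open>S\<close> that is odd for a grading of the space, that is, that interchanges the
image and the kernel of some idempotent \<open>E\<close>, is the sum of the two idempotents \<open>E + E * S\<close> and \<open>E + S * E\<close>
(\<open>sum_of_three_idempotents_odd\<close>). So it suffices to find one idempotent \<open>R\<close> and a grading for which
\<open>A \<oplus> 0 + R\<close> is odd.

By Fitting's lemma \<open>A\<close> is similar to \<open>U \<oplus> B\<close> with \<open>U\<close> strictly triangular and \<open>B\<close> invertible, of size \<open>b\<close>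
say, and \<open>B\<close> has the same trace as \<open>A\<close>. The Jordan form of \<open>U\<close> is supported on the superdiagonal and
hence is odd already, so all the work lies in \<open>B \<oplus> 0\<close> with \<open>b\<close> zeros.

A greedily chosen Krylov basis turns \<open>B\<close> into a Hessenberg matrix \<open>H\<close>: the basis falls into chains, each
vector is sent to its successor in the chain, and the end of a chain is sent to a combination of the
vectors up to itself (\<open>hessenberg_form\<close>). Give the vectors of every chain alternating degrees, with the ends
of all chains even. Then \<open>H\<close> is odd except at the chain ends, and among the chain ends its
degree-preserving part is an upper triangular block \<open>T\<close> with the same trace as \<open>A\<close>. The zeros supply each
chain with a predecessor of its first vector; this needs the first vector to lie in the image of \<open>H\<close>, whence the
separation of the nilpotent part. Now every chain end, even that of a chain of length 1, is the image of an
odd vector \<open>g\<close>.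

Adding combinations of the vectors \<open>g\<close>, with coefficient matrix \<open>V\<close>, to the chain ends changes the grading, and
the degree-preserving part becomes \<open>T + V\<close> on the new chain ends and \<open>V\<close> on the \<open>g\<close>. An idempotent \<open>R\<close>
cancels it if \<open>T + V + J Y = 1\<close> and \<open>V = Y J + K\<close>, where \<open>J\<close> is the nilpotent shift and \<open>K\<close> an idempotent in
one corner (locale \<open>coupled_grading\<close>). For upper triangular \<open>T\<close> the equations are solved by summing
\<open>1 + T\<close> along diagonals (\<open>staircase\<close>). The one remaining condition, obtained by taking traces, says that the
corner entry of \<open>K\<close> is the trace of \<open>T\<close> plus the number of chains. Idempotence of \<open>K\<close> forces this scalar
into \<open>{0, 1}\<close>, which is exactly the hypothesis on the trace of \<open>A\<close>.\<close>

section \<open>Sums of idempotent matrices\<close>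

lemma char2_add_self: 
  fixes x :: "'a::field" assumes "CHAR('a) = 2" shows "x + x = 0"
proof -
  have "(of_nat 2 :: 'a) = 0" using assms by (metis of_nat_CHAR)
  then have "(2::'a) = 0" by simp
  then show ?thesis by (metis mult_2 mult_zero_left)
qed

definition sum_of_three_idempotents :: "nat \<Rightarrow> 'a::field mat \<Rightarrow> bool" where
  "sum_of_three_idempotents N X \<longleftrightarrow> (\<exists>P \<in> carrier_mat N N. \<exists>Q \<in> carrier_mat N N. \<exists>R \<in> carrier_mat N N.
     idempotent_mat P \<and> idempotent_mat Q \<and> idempotent_mat R \<and> X = P + Q + R)"

lemma sum_of_three_idempotentsI:
  assumes "P \<in> carrier_mat N N" "Q \<in> carrier_mat N N" "R \<in> carrier_mat N N"
    and "idempotent_mat P" "idempotent_mat Q" "idempotent_mat R" "X = P + Q + R"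
  shows "sum_of_three_idempotents N X"
  using assms unfolding sum_of_three_idempotents_def by blast

lemma idempotent_matI: "P \<in> carrier_mat N N \<Longrightarrow> P * P = P \<Longrightarrow> idempotent_mat P"
  by (simp add: idempotent_mat_def)

lemma mat_add_zero_cancel:
  fixes A B :: "'a::field mat"
  assumes "A \<in> carrier_mat N N" "B \<in> carrier_mat N N" "A = A + B"
  shows "B = 0\<^sub>m N N"
proof (rule eq_matI)
  fix i j assume "i < dim_row (0\<^sub>m N N :: 'a mat)" "j < dim_col (0\<^sub>m N N :: 'a mat)"
  then have ij: "i < N" "j < N" by simp_all
  have "A $$ (i, j) = (A + B) $$ (i, j)" using assms(3) by (rule arg_cong)
  also have "\<dots> = A $$ (i, j) + B $$ (i, j)" using assms(1,2) ij by simp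
  finally show "B $$ (i, j) = 0\<^sub>m N N $$ (i, j)" using ij by simp
qed (use assms in auto)

text \<open>An idempotent \<open>E\<close> grades the space by its image and its kernel, and \<open>S = E * S + S * E\<close> says that
\<open>S\<close> interchanges the two summands, that is, \<open>S\<close> is odd. In characteristic 2 an odd matrix is
\<open>(E + E * S) + (E + S * E)\<close>, and both summands are idempotent because \<open>E * S * E = 0\<close>. The third
idempotent \<open>R\<close> serves to make \<open>X\<close> odd.\<close>

lemma sum_of_three_idempotents_odd:
  fixes X :: "'a::field mat"
  assumes char2: "CHAR('a) = 2" and carrier: "X \<in> carrier_mat N N" "E \<in> carrier_mat N N" "R \<in> carrier_mat N N"
    and E: "E * E = E" and R: "R * R = R"
    and odd: "X + R = E * (X + R) + (X + R) * E"
  shows "sum_of_three_idempotents N X"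
proof -
  define S where "S = X + R"
  have S [simp]: "S \<in> carrier_mat N N" using carrier by (simp add: S_def)
  note [simp] = carrier mult_carrier_mat[of _ N N _ N]
  have EES: "E * (E * S) = E * S" using E by (metis assoc_mult_mat carrier(2) S)
  have "E * S = E * (E * S + S * E)" using odd by (simp add: S_def)
  also have "\<dots> = E * S + E * (S * E)" by (subst mult_add_distrib_mat[of _ N N _ N]) (simp_all add: EES)
  finally have ESE: "E * (S * E) = 0\<^sub>m N N" by (rule mat_add_zero_cancel[rotated 2]) simp_all
  have SEE: "S * E * E = S * E" using E by (simp add: assoc_mult_mat[of _ N N _ N _ N])
  have EE': "E * (E * Z) = E * Z" "E * (S * (E * Z)) = 0\<^sub>m N N" if "Z \<in> carrier_mat N N" for Z
    using that E ESE 
    by (simp_all add: assoc_mult_mat[of _ N N _ N _ N, symmetric])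
  have P: "idempotent_mat (E + E * S)"
    by (rule idempotent_matI[of _ N])
      (simp_all add: add_mult_distrib_mat[of _ N N _ _ N] mult_add_distrib_mat[of _ N N _ N] 
        assoc_mult_mat[of _ N N _ N _ N] EE' E ESE right_mult_zero_mat[of _ N N])
  have Q: "idempotent_mat (E + S * E)"
    by (rule idempotent_matI[of _ N])
      (simp_all add: add_mult_distrib_mat[of _ N N _ _ N] mult_add_distrib_mat[of _ N N _ N] 
        assoc_mult_mat[of _ N N _ N _ N] EE' E ESE right_mult_zero_mat[of _ N N])
  have "X = (E + E * S) + (E + S * E) + R"
  proof (rule eq_matI)
    fix i j assume "i < dim_row ((E + E * S) + (E + S * E) + R)" "j < dim_col ((E + E * S) + (E + S * E) + R)"
    then have ij: "i < N" "j < N" using carrier_matD[OF carrier(3)] by simp_all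
    have "S $$ (i, j) = (E * S + S * E) $$ (i, j)"
      using odd unfolding S_def by (rule arg_cong)
    also have "\<dots> = (E * S) $$ (i, j) + (S * E) $$ (i, j)"
      using ij by (intro index_add_mat(1)) (simp_all add: carrier_matD[OF S] carrier_matD[OF carrier(2)])
    finally have "S $$ (i, j) = (E * S) $$ (i, j) + (S * E) $$ (i, j)" .
    moreover have "S $$ (i, j) = X $$ (i, j) + R $$ (i, j)"
      using ij carrier_matD[OF carrier(3)] by (simp add: S_def)
    ultimately have "X $$ (i,j) + R $$ (i,j) = (E * S) $$ (i,j) + (S * E) $$ (i,j)" by simp
    moreover have "X $$ (i,j) = X $$ (i,j) + R $$ (i,j) + R $$ (i,j) + (E $$ (i,j) + E $$ (i,j))"
      by (simp add: add.assoc char2_add_self[OF char2])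
    ultimately show "X $$ (i, j) = ((E + E * S) + (E + S * E) + R) $$ (i, j)"
      using ij by (simp add: ac_simps carrier_matD[OF S] carrier_matD[OF carrier(2)] carrier_matD[OF carrier(3)]
        del: index_mult_mat(1))
  qed (use carrier_matD[OF carrier(1)] carrier_matD[OF carrier(3)] in simp_all)
  then show ?thesis
    by (intro sum_of_three_idempotentsI[OF _ _ carrier(3) P Q idempotent_matI[OF carrier(3) R]]) simp_all
qed

lemma sum_of_three_idempotents_similar:
  fixes X Z :: "'a::field mat"
  assumes "similar_mat X Z" "X \<in> carrier_mat N N" "sum_of_three_idempotents N Z"
  shows "sum_of_three_idempotents N X"
proof -
  obtain S S' where wit: "similar_mat_wit X Z S S'" using assms(1) by (auto simp: similar_mat_def)
  note w = similar_mat_witD2[OF assms(2) wit]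
  note [simp] = w(4-7) mult_carrier_mat[of _ N N _ N]
  have conj: "idempotent_mat (S * P * S')" if "P \<in> carrier_mat N N" "idempotent_mat P" for P
  proof -
    note [simp] = that(1)
    have PP: "P * (P * S') = P * S'" 
      using that(2) by (simp add: idempotent_mat_def assoc_mult_mat[of _ N N _ N _ N, symmetric])
    have S'S: "S' * (S * B) = B" if "B \<in> carrier_mat N N" for B
      using that w(2) by (simp add: assoc_mult_mat[of _ N N _ N _ N, symmetric])
    show ?thesis
      by (rule idempotent_matI[of _ N]) (simp_all add: assoc_mult_mat[of _ N N _ N _ N] S'S PP)
  qed
  obtain P Q R where PQR: "P \<in> carrier_mat N N" "Q \<in> carrier_mat N N" "R \<in> carrier_mat N N"
    "idempotent_mat P" "idempotent_mat Q" "idempotent_mat R" "Z = P + Q + R"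
    using assms(3) unfolding sum_of_three_idempotents_def by auto
  note [simp] = PQR(1-3)
  have "X = S * P * S' + S * Q * S' + S * R * S'"
    using w(3) PQR(7) by (simp add: add_mult_distrib_mat[of _ N N _ _ N] mult_add_distrib_mat[of _ N N _ N])
  then show ?thesis
    using PQR by (intro sum_of_three_idempotentsI[OF _ _ _ conj conj conj]) simp_all
qed

lemma sum_of_three_idempotents_diag:
  assumes "A \<in> carrier_mat m m" "B \<in> carrier_mat n n" 
    and "sum_of_three_idempotents m A" "sum_of_three_idempotents n B"
  shows "sum_of_three_idempotents (m + n) (four_block_mat A (0\<^sub>m m n) (0\<^sub>m n m) B)"
proof -
  let ?D = "\<lambda>X Y. four_block_mat X (0\<^sub>m m n) (0\<^sub>m n m) Y"
  have idem: "idempotent_mat (?D X Y)"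
    if "X \<in> carrier_mat m m" "Y \<in> carrier_mat n n" "idempotent_mat X" "idempotent_mat Y" for X Y :: "'a mat"
    using that by (intro idempotent_matI[of _ "m + n"]) 
      (simp_all add: mult_four_block_mat[of _ m m _ n _ n _ _ m _ n] idempotent_mat_def)
  obtain P Q R where PQR: "P \<in> carrier_mat m m" "Q \<in> carrier_mat m m" "R \<in> carrier_mat m m"
    "idempotent_mat P" "idempotent_mat Q" "idempotent_mat R" "A = P + Q + R"
    using assms(3) unfolding sum_of_three_idempotents_def by auto
  obtain P' Q' R' where PQR': "P' \<in> carrier_mat n n" "Q' \<in> carrier_mat n n" "R' \<in> carrier_mat n n"
    "idempotent_mat P'" "idempotent_mat Q'" "idempotent_mat R'" "B = P' + Q' + R'"
    using assms(4) unfolding sum_of_three_idempotents_def by auto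
  have "?D A B = ?D P P' + ?D Q Q' + ?D R R'"
    using PQR PQR' by (simp add: add_four_block_mat[of _ m m _ n _ n])
  then show ?thesis
    using PQR PQR' by (intro sum_of_three_idempotentsI[OF _ _ _ idem idem idem]) simp_all
qed

lemma sum_of_three_idempotents_zero: "sum_of_three_idempotents N (0\<^sub>m N N :: 'a::field mat)"
  unfolding sum_of_three_idempotents_def
  by (intro bexI[of _ "0\<^sub>m N N"]) (auto simp: idempotent_mat_def)

section \<open>Gradings adapted to an operator\<close>

text \<open>Data from which an idempotent \<open>R\<close> and a grading \<open>E'\<close> are built such that \<open>M + R\<close> is odd for \<open>E'\<close>.
The given grading \<open>E\<close> has distinguished vectors \<open>l w\<close> in its even part and \<open>g w\<close> in its odd part,
with coordinate maps \<open>lc\<close> and \<open>gc\<close>; \<open>I\<close> projects the parameter space onto the coordinates in use.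
By \<open>M_even\<close>, \<open>M_odd\<close> and \<open>M_g\<close> the operator \<open>M\<close> is odd for \<open>E\<close> except on the vectors \<open>l w\<close>,
where the only essential defect is the compression \<open>T = lc \<circ> M \<circ> l\<close>.

Replacing \<open>l\<close> by \<open>l' = l + g \<circ> V\<close> changes the even part without touching the odd part. Since \<open>M\<close>
sends \<open>g w\<close> to \<open>l w = l' w + g (V w)\<close>, the defects now are \<open>T + V\<close> on the \<open>l' w\<close> and \<open>V\<close> on the \<open>g w\<close>.
The equations \<open>balance\<close> and \<open>V_split\<close> make these the diagonal blocks of the idempotent
\<open>[[T + V, (T + V) J], [Y, Y J + K]]\<close>. This idempotent is the sum of the product of the column \<open>(T + V, Y)\<close>
with the row \<open>(1, J)\<close>, where row times column is \<open>T + V + J Y = 1\<close>, and of an idempotent corner \<open>K\<close>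
orthogonal to that product; the corner allows the rank of \<open>R\<close> to have either parity.\<close>

locale coupled_grading =
  fixes E M :: "'v::ab_group_add \<Rightarrow> 'v"
    and l g :: "'w::ab_group_add \<Rightarrow> 'v" and lc gc :: "'v \<Rightarrow> 'w"
    and V Y J K I :: "'w \<Rightarrow> 'w"
  assumes char2: "\<And>v::'v. v + v = 0" "\<And>w::'w. w + w = 0"
    and add: "\<And>v v'. E (v + v') = E v + E v'" "\<And>v v'. M (v + v') = M v + M v'"
      "\<And>w w'. l (w + w') = l w + l w'" "\<And>w w'. g (w + w') = g w + g w'"
      "\<And>v v'. lc (v + v') = lc v + lc v'" "\<And>v v'. gc (v + v') = gc v + gc v'"
      "\<And>w w'. V (w + w') = V w + V w'" "\<And>w w'. Y (w + w') = Y w + Y w'"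
      "\<And>w w'. J (w + w') = J w + J w'" "\<And>w w'. K (w + w') = K w + K w'"
    and grading: "\<And>v. E (E v) = E v" "\<And>w. E (l w) = l w" "\<And>w. E (g w) = 0"
      "\<And>v. lc (E v) = lc v" "\<And>v. gc (E v) = 0"
    and dual: "\<And>w. lc (l w) = I w" "\<And>w. gc (g w) = I w" "\<And>w. lc (g w) = 0" "\<And>w. gc (l w) = 0"
    and I_unit: "\<And>w. l (I w) = l w" "\<And>w. g (I w) = g w" "\<And>w. V (I w) = V w" 
      "\<And>w. Y (I w) = Y w" "\<And>w. J (I w) = J w" "\<And>w. K (I w) = K w"
      "\<And>v. I (lc v) = lc v" "\<And>v. I (gc v) = gc v" "\<And>w. I (V w) = V w" "\<And>w. I (J w) = J w"
      "\<And>w. I (Y w) = Y w"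
    and M_g: "\<And>w. M (g w) = l w"
    and M_even: "\<And>v. E (M (E v + l (lc v))) = 0"
    and M_odd: "\<And>v. E (M (v + E v + g (gc v))) = M (v + E v + g (gc v))"
      "\<And>v. lc (M (v + E v + g (gc v))) = 0"
    and V_split: "\<And>w. V w = Y (J w) + K w"
    and balance: "\<And>w. lc (M (l w)) + V w + J (Y w) = I w"
    and K_corner: "\<And>w. K (Y w) = 0" "\<And>w. J (K w) = 0" "\<And>w. K (K w) = K w"
begin

text \<open>The primed maps belong to the new grading: \<open>lc\<close> and \<open>gc'\<close> are the coordinates with respect to \<open>l'\<close>
and \<open>g\<close>, and \<open>E'\<close> is the projection with the kernel of \<open>E\<close> and the new even part as image. \<open>C\<close> and
\<open>W\<close> are the column and the row of \<open>R\<close>; the component \<open>E' (M (l' w))\<close> of \<open>C w\<close> removes the whole even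
part of \<open>M (l' w)\<close>, not only its coordinates along \<open>l'\<close>.\<close>

definition l' where "l' w = l w + g (V w)"
definition gc' where "gc' v = gc v + V (lc v)"
definition E' where "E' v = E v + g (V (lc v))"
definition W where "W v = lc v + J (gc' v)"
definition C where "C w = E' (M (l' w)) + g (Y w)"
definition R where "R v = C (W v) + g (K (gc' v))"

lemma zero: "E 0 = 0" "M 0 = 0" "l 0 = 0" "g 0 = 0" "lc 0 = 0" "gc 0 = 0" "V 0 = 0" "Y 0 = 0" "J 0 = 0" "K 0 = 0"
  by (metis add add_cancel_left_left)+

lemma cancel: "v + v + x = (x::'v)" "v + (v + x) = x" "w + w + y = (y::'w)" "w + (w + y) = y"
  using char2 by (simp_all add: add.assoc [symmetric])

lemma eq_iff_sum: "(x::'v) = y \<longleftrightarrow> x + y = 0" "(x'::'w) = y' \<longleftrightarrow> x' + y' = 0"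
  using char2 by (metis add_left_imp_eq)+

lemmas simps = add zero cancel char2 grading dual I_unit M_g

lemma add': "E' (x + y) = E' x + E' y" "l' (w + z) = l' w + l' z" "gc' (x + y) = gc' x + gc' y"
  "W (x + y) = W x + W y" "C (w + z) = C w + C z" "R (x + y) = R x + R y"
  by (simp_all add: E'_def l'_def gc'_def W_def C_def R_def add ac_simps)

lemma zero': "E' 0 = 0" "l' 0 = 0" "gc' 0 = 0" "W 0 = 0" "C 0 = 0"
  by (simp_all add: E'_def l'_def gc'_def W_def C_def zero)

lemma E'_idem: "E' (E' v) = E' v"
  by (simp add: E'_def simps)

lemma lc_E': "lc (E' v) = lc v" and gc'_E': "gc' (E' v) = 0" and gc'_g: "gc' (g w) = I w"
  and E'_g: "E' (g w) = 0" and E'_l': "E' (l' w) = l' w" and gc'_l': "gc' (l' w) = 0"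
  and W_g: "W (g w) = J w" and W_l': "W (l' w) = I w"
  by (simp_all add: E'_def gc'_def l'_def W_def simps)

lemma gc'_C: "gc' (C w) = Y w" by (simp add: C_def add' gc'_E' gc'_g I_unit)

lemma W_C: "W (C w) = I w"
proof -
  have "lc (C w) = lc (M (l w)) + V w"
    by (simp add: C_def lc_E' l'_def simps)
  then show ?thesis using balance by (simp add: W_def gc'_C)
qed

lemma C_I: "C (I w) = C w"
  by (simp add: C_def l'_def I_unit)

lemma R_idem: "R (R v) = R v"
  by (simp add: R_def add' W_C gc'_C gc'_g W_g K_corner C_I zero' simps)

definition S where "S v = M v + R v"

lemma S_add: "S (x + y) = S x + S y" by (simp add: S_def add' add ac_simps)

text \<open>Every vector is a sum of an even vector without \<open>l\<close>-coordinates, an odd vector without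
\<open>g\<close>-coordinates, and vectors \<open>l' w\<close> and \<open>g w\<close>. The first two kinds are killed by \<open>R\<close>, and oddness is that of
\<open>M\<close>; on the last two, \<open>R\<close> cancels exactly the part of \<open>M\<close> that preserves the degree.\<close>

lemma S_odd: "S v = E' (S v) + S (E' v)"
proof -
  \<comment> \<open>components of \<open>v\<close> in the even and odd part without the \<open>l\<close> and \<open>g\<close> directions\<close>
  define n1 where "n1 = E v + l (lc v)"
  define n2 where "n2 = v + E v + g (gc v)"
  define odd where "odd x \<longleftrightarrow> S x = E' (S x) + S (E' x)" for x
  have odd_add: "odd x \<Longrightarrow> odd y \<Longrightarrow> odd (x + y)" for x y
    unfolding odd_def by (simp add: S_add add' ac_simps)
  have "odd n1"
  proof -
    have z: "lc n1 = 0" "gc' n1 = 0" "E' n1 = n1"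
      by (simp_all add: n1_def gc'_def E'_def simps)
    have "R n1 = 0" by (simp add: R_def W_def z zero zero')
    moreover have "E (M n1) = 0" using M_even by (simp add: n1_def)
    moreover from this have "lc (M n1) = 0" by (metis grading(4) zero(5))
    ultimately show ?thesis by (simp add: odd_def S_def E'_def[of "M n1"] z zero)
  qed
  moreover have "odd n2"
  proof -
    have z: "lc n2 = 0" "gc' n2 = 0" "E' n2 = 0"
      by (simp_all add: n2_def gc'_def E'_def simps)
    have "R n2 = 0" by (simp add: R_def W_def z zero zero')
    moreover have "E (M n2) = M n2" "lc (M n2) = 0" using M_odd by (simp_all add: n2_def)
    ultimately show ?thesis by (simp add: odd_def S_def z E'_def[of "M n2"] R_def zero zero')
  qed
  moreover have "odd (l' w)" for w
  proof -
    have "S (l' w) = M (l' w) + C w"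
      by (simp add: S_def R_def W_l' gc'_l' C_I zero)
    then have "E' (S (l' w)) = 0"
      by (simp add: C_def add' E'_idem E'_g char2)
    then show ?thesis by (simp add: odd_def E'_l')
  qed
  moreover have "odd (g w)" for w
  proof -
    have "S (g w) = l w + E' (M (l' (J w))) + g (Y (J w)) + g (K w)"
      by (simp add: S_def R_def W_g gc'_g C_def M_g I_unit ac_simps)
    also have "\<dots> = l' w + E' (M (l' (J w)))"
      by (simp add: l'_def V_split add ac_simps)
    finally show ?thesis
      by (simp add: odd_def E'_g add' E'_l' E'_idem S_def M_g R_def W_def zero zero')
  qed
  moreover have "v = n1 + n2 + l' (lc v) + g (gc' v)"
    by (subst eq_iff_sum) (simp add: n1_def n2_def l'_def gc'_def add ac_simps cancel char2)
  ultimately show ?thesis using odd_add odd_def by metis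
qed

end

section \<open>A shift equation for upper triangular matrices\<close>

text \<open>The matrix \<open>V\<close> of the preceding section for a given \<open>T\<close>, where \<open>J\<close> is the shift with entries 1 at
\<open>(i, i + 1)\<close> and \<open>K\<close> has the single entry \<open>\<epsilon>\<close> at \<open>(0, 0)\<close>. With the choice \<open>Y i j = V i (j + 1)\<close> the equation
\<open>V = Y J + K\<close> prescribes column 0, and \<open>T + V + J Y = 1\<close> becomes the recursion along diagonals. Row 0
is chosen as \<open>(\<epsilon>, 0, 0, \<dots>)\<close>, which gives \<open>K Y = 0\<close>. For matrices of size \<open>k\<close> the product \<open>J Y\<close> has last row zero, so the
solution is valid if row \<open>k\<close> of the staircase vanishes in the columns \<open>1, \<dots>, k\<close>: left of the diagonal this
holds for upper triangular \<open>T\<close>, and on the diagonal it fixes \<open>\<epsilon>\<close> in terms of the trace of \<open>T\<close>.\<close>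

fun staircase :: "'a::field \<Rightarrow> (nat \<Rightarrow> nat \<Rightarrow> 'a) \<Rightarrow> nat \<Rightarrow> nat \<Rightarrow> 'a" where
  "staircase \<epsilon> T 0 0 = \<epsilon>"
| "staircase \<epsilon> T 0 (Suc j) = 0"
| "staircase \<epsilon> T (Suc i) 0 = 0"
| "staircase \<epsilon> T (Suc i) (Suc j) = (if i = j then 1 else 0) + T i j + staircase \<epsilon> T i j"

lemma staircase_lower:
  assumes "\<And>i j. j < i \<Longrightarrow> i < k \<Longrightarrow> T i j = 0" "j < i" "i \<le> k"
  shows "staircase \<epsilon> T i j = 0"
  using assms(2,3)
proof (induction i arbitrary: j)
  case (Suc i)
  then show ?case using assms(1)[of "j - 1" i] by (cases j) auto
qed simp

lemma staircase_diag: "staircase \<epsilon> T k k = \<epsilon> + (\<Sum>i<k. 1 + T i i)"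
  by (induction k) (auto simp: ac_simps)

section \<open>Matrices as operators on sequences\<close>

text \<open>Sequences form an abelian group, so operators on them can be used for the abstract maps above. The
following transports their identities to \<open>N \<times> N\<close> matrices, which record the action on the first \<open>N\<close>
unit sequences.\<close>

definition linear_fun :: "((nat \<Rightarrow> 'a::field) \<Rightarrow> (nat \<Rightarrow> 'a)) \<Rightarrow> bool" where
  "linear_fun f \<longleftrightarrow> (\<forall>x y. f (x + y) = f x + f y) \<and> (\<forall>c x. f (\<lambda>i. c * x i) = (\<lambda>i. c * f x i))"

lemma linear_funD: "linear_fun f \<Longrightarrow> f (x + y) = f x + f y" "linear_fun f \<Longrightarrow> f (\<lambda>i. c * x i) = (\<lambda>i. c * f x i)"
  by (auto simp: linear_fun_def)

lemma linear_fun_comp: "linear_fun f \<Longrightarrow> linear_fun h \<Longrightarrow> linear_fun (\<lambda>x. f (h x))"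
  by (simp add: linear_fun_def)

lemma linear_fun_add: "linear_fun f \<Longrightarrow> linear_fun h \<Longrightarrow> linear_fun (\<lambda>x. f x + h x)"
  by (auto simp: linear_fun_def fun_eq_iff algebra_simps)

definition unit_fun :: "nat \<Rightarrow> nat \<Rightarrow> 'a::field" where
  "unit_fun j i = (if i = j then 1 else 0)"

definition mat_of_fun :: "nat \<Rightarrow> ((nat \<Rightarrow> 'a::field) \<Rightarrow> (nat \<Rightarrow> 'a)) \<Rightarrow> 'a mat" where
  "mat_of_fun N f = mat N N (\<lambda>(i, j). f (unit_fun j) i)"

lemma mat_of_fun_carrier [simp]: "mat_of_fun N f \<in> carrier_mat N N"
  by (simp add: mat_of_fun_def)

lemma linear_fun_expand:
  assumes f: "linear_fun f"
  shows "f (\<lambda>i. if i < N then v i else 0) i' = (\<Sum>m<N. v m * f (unit_fun m) i')"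
proof (induction N)
  case 0
  have "f (\<lambda>i. 0) = (\<lambda>i. 0)" using linear_funD(2)[OF f, of 0] by simp
  then show ?case by (simp add: fun_eq_iff)
next
  case (Suc N)
  have "(\<lambda>i. if i < Suc N then v i else 0) = (\<lambda>i. if i < N then v i else 0) + (\<lambda>i. v N * unit_fun N i)"
    by (auto simp: fun_eq_iff unit_fun_def less_Suc_eq)
  then show ?case using Suc by (simp add: linear_funD[OF f])
qed

text \<open>The values of \<open>h\<close> must be supported on the first \<open>N\<close> indices, since the matrix of \<open>f\<close> ignores how \<open>f\<close>
acts on the others.\<close>

lemma mat_of_fun_comp:
  assumes f: "linear_fun f" and h: "\<And>v i. N \<le> i \<Longrightarrow> h v i = 0"
  shows "mat_of_fun N (\<lambda>x. f (h x)) = mat_of_fun N f * mat_of_fun N h"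
proof (rule eq_matI)
  fix i j assume ij: "i < dim_row (mat_of_fun N f * mat_of_fun N h)" "j < dim_col (mat_of_fun N f * mat_of_fun N h)"
  have "h (unit_fun j) = (\<lambda>i. if i < N then h (unit_fun j) i else 0)"
    using h by (auto simp: fun_eq_iff)
  then have "f (h (unit_fun j)) i = (\<Sum>m<N. h (unit_fun j) m * f (unit_fun m) i)"
    by (metis linear_fun_expand [OF f])
  then show "mat_of_fun N (\<lambda>x. f (h x)) $$ (i, j) = (mat_of_fun N f * mat_of_fun N h) $$ (i, j)"
    using ij by (simp add: mat_of_fun_def scalar_prod_def atLeast0LessThan mult.commute)
qed (auto simp: mat_of_fun_def)

lemma mat_of_fun_add: "mat_of_fun N (\<lambda>x. f x + h x) = mat_of_fun N f + mat_of_fun N h"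
  by (rule eq_matI) (auto simp: mat_of_fun_def)

section \<open>Padded Hessenberg matrices\<close>

text \<open>The first \<open>n\<close> indices are divided into chains of consecutive indices whose last elements form \<open>L\<close>. The
matrix \<open>H\<close> is to be thought of as sending each basis vector to its successor in the chain, and each
chain end to a combination of itself and its predecessors; only the latter columns are recorded here.\<close>

locale hessenberg =
  fixes n :: nat and H :: "'a::field mat" and L :: "nat set"
  assumes CHAR: "CHAR('a) = 2"
    and L: "L \<subseteq> {..<n}"
    and chain_end: "\<And>j. j < n \<Longrightarrow> j \<notin> L \<Longrightarrow> Suc j < n"
    and upper: "\<And>i j. j \<in> L \<Longrightarrow> j < i \<Longrightarrow> i < n \<Longrightarrow> H $$ (i, j) = 0"
    and trace: "(\<Sum>j\<in>L. H $$ (j, j)) \<in> {0, 1}"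
begin

text \<open>\<open>M\<close> is the operator \<open>[[H, F], [0, 0]]\<close> on \<open>2 * n\<close> coordinates in which every start \<open>j\<close> of a chain is the image
of the pad \<open>n + j\<close>. In this way every \<open>j < n\<close>, even a chain of length one, has a predecessor that is not
a chain end. The parity \<open>part\<close> alternates along the chains, pads included, and makes all chain ends
even, so that \<open>M\<close> is odd except at chain ends. The vectors \<open>l\<close> are the chain ends and the vectors \<open>g\<close> are their
predecessors; \<open>T\<close> is the block of \<open>H\<close> on the chain ends, listed in increasing order by \<open>ell\<close>.\<close>

definition pred where "pred j = (if j = 0 \<or> j - 1 \<in> L then n + j else j - 1)"
definition dist_end where "dist_end j = (LEAST d. j + d \<in> L)"
definition part where "part j = (if j < n then even (dist_end j) else odd (dist_end (j - n)))"
definition k where "k = card L"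
definition ell where "ell a = sorted_list_of_set L ! a"

definition E where "E v i = (if i < 2 * n \<and> part i then v i else (0::'a))"
definition M where "M v i = (if i < n then v (pred i) + (\<Sum>j\<in>L. H $$ (i, j) * v j) else 0)"
definition l where "l x j = (\<Sum>a<k. of_bool (j = ell a) * (x a :: 'a))"
definition g where "g x j = (\<Sum>a<k. of_bool (j = pred (ell a)) * (x a :: 'a))"
definition lc where "lc v a = (if a < k then v (ell a) else (0::'a))"
definition gc where "gc v a = (if a < k then v (pred (ell a)) else (0::'a))"
definition T where "T a b = H $$ (ell a, ell b)"
definition eps where "eps = (\<Sum>a<k. 1 + T a a)"
definition s where "s = staircase eps T"
definition V where "V x a = (if a < k then \<Sum>b<k. s a b * x b else 0)"
definition Y where "Y x a = (if a < k then \<Sum>b<k. s a (Suc b) * x b else 0)"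
definition J where "J x a = (if Suc a < k then x (Suc a) else (0::'a))"
definition K :: "(nat \<Rightarrow> 'a) \<Rightarrow> nat \<Rightarrow> 'a" where
  "K x a = (if a = 0 \<and> 0 < k then eps * x 0 else 0)"
definition I where "I x a = (if a < k then x a else (0::'a))"

lemma finite_L: "finite L" using L finite_subset by blast

lemma ell_L: "a < k \<Longrightarrow> ell a \<in> L"
  unfolding ell_def k_def using finite_L by (metis length_sorted_list_of_set nth_mem set_sorted_list_of_set)

lemma ell_less: "a < k \<Longrightarrow> ell a < n" using ell_L L by auto

lemma ell_mono: "a < b \<Longrightarrow> b < k \<Longrightarrow> ell a < ell b"
  unfolding ell_def k_def using finite_L
  by (simp add: sorted_wrt_nth_less[OF strict_sorted_list_of_set])

lemma ell_eq_iff: "a < k \<Longrightarrow> b < k \<Longrightarrow> ell a = ell b \<longleftrightarrow> a = b"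
  by (metis ell_mono linorder_neqE_nat less_irrefl)

lemma L_ell: "j \<in> L \<Longrightarrow> \<exists>a<k. j = ell a"
  unfolding ell_def k_def using finite_L 
  by (metis in_set_conv_nth length_sorted_list_of_set set_sorted_list_of_set)

lemma sum_L: "(\<Sum>j\<in>L. f j) = (\<Sum>a<k. f (ell a))"
proof (rule sum.reindex_cong[of ell])
  show "inj_on ell {..<k}" by (auto simp: inj_on_def ell_eq_iff)
  show "L = ell ` {..<k}" using ell_L L_ell by auto
qed simp

lemma pred_less: "j < n \<Longrightarrow> pred j < 2 * n" by (auto simp: pred_def)

lemma pred_notin_L: "j < n \<Longrightarrow> pred j \<notin> L" using L by (auto simp: pred_def)

lemma pred_eq_iff: "i < n \<Longrightarrow> j < n \<Longrightarrow> pred i = pred j \<longleftrightarrow> i = j"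
  by (auto simp: pred_def split: if_splits)

lemma exists_end: "j < n \<Longrightarrow> \<exists>d. j + d \<in> L"
proof (induction "n - j" arbitrary: j)
  case (Suc m)
  show ?case
  proof (cases "j \<in> L")
    case True then show ?thesis by (metis add_0_right)
  next
    case False
    then have "Suc j < n" using chain_end Suc.prems by blast
    moreover have "m = n - Suc j" using Suc.hyps(2) by simp
    ultimately obtain d where "Suc j + d \<in> L" using Suc.hyps(1) by blast
    then show ?thesis by (metis add_Suc_shift)
  qed
qed simp

lemma part_L: "j \<in> L \<Longrightarrow> part j"
  using L by (auto simp: part_def dist_end_def intro: Least_equality)

lemma dist_end_Suc: "j < n \<Longrightarrow> j \<notin> L \<Longrightarrow> dist_end j = Suc (dist_end (Suc j))"
  unfolding dist_end_def using exists_end[of j] Least_Suc[of "\<lambda>d. j + d \<in> L"]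
  by auto

lemma part_pred: "j < n \<Longrightarrow> part (pred j) \<longleftrightarrow> \<not> part j"
  using dist_end_Suc[of "j - 1"] by (auto simp: part_def pred_def)

lemma l_ell: "a < k \<Longrightarrow> l x (ell a) = x a"
  unfolding l_def by (subst sum.cong[OF refl, of _ _ "\<lambda>b. if a = b then x b else 0"]) (auto simp: ell_eq_iff)

lemma l_notin: "j \<notin> L \<Longrightarrow> l x j = 0"
  unfolding l_def using ell_L by (intro sum.neutral) auto

lemma g_pred: "a < k \<Longrightarrow> g x (pred (ell a)) = x a"
  unfolding g_def by (subst sum.cong[OF refl, of _ _ "\<lambda>b. if a = b then x b else 0"])
    (auto simp: ell_eq_iff ell_less pred_eq_iff)

lemma g_notin: "j \<notin> pred ` L \<Longrightarrow> g x j = 0"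
  unfolding g_def using ell_L by (intro sum.neutral) auto

text \<open>This is where the trace matters: the corner \<open>K\<close> is idempotent only if \<open>eps\<close>, which is the trace of
\<open>T\<close> plus the number of chains, is an idempotent scalar.\<close>

lemma eps_cases: "eps \<in> {0, 1}"
proof -
  have "(\<Sum>a<m. 1::'a) \<in> {0,1}" for m :: nat
    using char2_add_self[OF CHAR, of 1] by (induction m) auto
  then have "(\<Sum>a<k. 1::'a) \<in> {0,1}" .
  moreover have "(\<Sum>a<k. T a a) \<in> {0, 1}" using trace by (simp add: T_def sum_L)
  ultimately show ?thesis
    using char2_add_self[OF CHAR, of 1] unfolding eps_def sum.distrib
    by (smt (verit, ccfv_threshold) add_0 add_0_right insert_iff singletonD)
qed

lemma T_lower: "b < a \<Longrightarrow> a < k \<Longrightarrow> T a b = 0"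
  unfolding T_def using upper ell_L ell_mono ell_less by auto

lemma s_last: "b < k \<Longrightarrow> s k (Suc b) = 0"
proof (cases "Suc b = k")
  case True
  then show ?thesis unfolding s_def
    using staircase_diag[of eps T k] char2_add_self[OF CHAR] by (simp add: eps_def)
qed (auto simp: s_def intro: staircase_lower T_lower)

lemma JY: "J (Y x) a = (if a < k then \<Sum>b<k. s (Suc a) (Suc b) * x b else 0)"
proof (cases "Suc a = k")
  case True
  then show ?thesis using s_last by (simp add: J_def)
qed (auto simp: J_def Y_def)

lemma VYJ: "V x = Y (J x) + K x"
proof
  fix a
  show "V x a = (Y (J x) + K x) a"
  proof (cases "a < k")
    case True
    then obtain k' where k: "k = Suc k'" by (cases k) auto
    have "V x a = s a 0 * x 0 + (\<Sum>b<k'. s a (Suc b) * x (Suc b))"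
      using True by (simp add: V_def k sum.lessThan_Suc_shift del: sum.lessThan_Suc)
    moreover have "s a 0 * x 0 = K x a" using True by (cases a) (auto simp: K_def s_def)
    moreover have "Y (J x) a = (\<Sum>b<k'. s a (Suc b) * x (Suc b))"
      using True by (simp add: Y_def J_def k)
    ultimately show ?thesis by simp
  qed (auto simp: V_def Y_def K_def)
qed

lemma g_L: "j \<in> L \<Longrightarrow> g x j = 0"
  using pred_notin_L L by (intro g_notin) auto

lemma l_pred: "j < n \<Longrightarrow> l x (pred j) = 0"
  by (simp add: l_notin pred_notin_L)

lemma fun_add_self: "x + x = (0::nat \<Rightarrow> 'a)" using char2_add_self[OF CHAR] by (auto simp: fun_eq_iff)

lemma E_l: "E (l x) = l x"
proof
  fix j show "E (l x) j = l x j"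
    using l_notin[of j x] part_L[of j] L by (cases "j \<in> L") (auto simp: E_def)
qed

lemma not_part_pred: "j \<in> L \<Longrightarrow> \<not> part (pred j)" using part_pred part_L L by auto

lemma E_g: "E (g x) = 0"
proof
  fix j show "E (g x) j = 0 j"
    using g_notin[of j x] not_part_pred by (cases "j \<in> pred ` L") (auto simp: E_def)
qed

lemma lc_E: "lc (E v) = lc v"
  using ell_less ell_L part_L by (force simp: fun_eq_iff lc_def E_def)

lemma gc_E: "gc (E v) = 0"
  using ell_L not_part_pred by (auto simp: fun_eq_iff gc_def E_def)

text \<open>The pads are what makes this possible: distinct indices below \<open>n\<close> have distinct predecessors, and no
predecessor is a chain end.\<close>

lemma M_g: "M (g x) = l x"
proof
  fix i
  have *: "(\<Sum>j\<in>L. H $$ (i, j) * g x j) = 0" by (simp add: g_L)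
  show "M (g x) i = l x i"
  proof (cases "i \<in> L")
    case True
    then obtain a where "a < k" "i = ell a" using L_ell by blast
    then show ?thesis using * by (simp add: M_def ell_less g_pred l_ell)
  next
    case False
    then have "g x (pred i) = 0" if "i < n"
      using that L by (intro g_notin) (auto simp: pred_eq_iff)
    then show ?thesis using * False by (simp add: M_def l_notin)
  qed
qed

lemma M_even: "E (M (E v + l (lc v))) = 0"
proof
  fix i
  let ?x = "E v + l (lc v)"
  have "?x j = 0" if j: "j \<in> L" for j
  proof -
    obtain a where "a < k" "j = ell a" using L_ell[OF j] by auto
    then show ?thesis using part_L[OF j] char2_add_self[OF CHAR] ell_less[of a]
      by (simp add: E_def l_ell lc_def)
  qed
  moreover have "?x (pred i) = 0" if "part i" "i < n"
    using that by (simp add: E_def part_pred l_pred)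
  ultimately show "E (M ?x) i = 0 i" by (auto simp: E_def[of "M _"] M_def)
qed

lemma M_odd: 
  fixes v defines "x \<equiv> v + E v + g (gc v)"
  shows "E (M x) = M x" "lc (M x) = 0"
proof -
  have L0: "x j = 0" if "j \<in> L" for j
    using part_L[OF that] char2_add_self[OF CHAR] that L
    by (force simp: x_def E_def g_L)
  have pL: "x (pred (ell a)) = 0" if "a < k" for a
    using that not_part_pred[OF ell_L, of a] char2_add_self[OF CHAR] 
    by (simp add: x_def E_def g_pred gc_def)
  have M: "M x i = (if i < n then x (pred i) else 0)" for i by (simp add: M_def L0)
  show "lc (M x) = 0" using pL by (auto simp: fun_eq_iff lc_def M)
  have "x (pred i) = 0" if "i < n" "\<not> part i" for i
  proof -
    have "pred i \<notin> pred ` L" using that part_L L by (auto simp: pred_eq_iff)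
    then show ?thesis using that pred_less[of i] char2_add_self[OF CHAR]
      by (simp add: x_def E_def part_pred g_notin)
  qed
  then show "E (M x) = M x" by (auto simp: fun_eq_iff E_def M)
qed

lemma balance: "lc (M (l x)) + V x + J (Y x) = I x"
proof
  fix a
  show "(lc (M (l x)) + V x + J (Y x)) a = I x a"
  proof (cases "a < k")
    case True
    have "(\<Sum>b<k. H $$ (ell a, ell b) * l x (ell b)) = (\<Sum>b<k. T a b * x b)"
      by (rule sum.cong) (simp_all add: l_ell T_def)
    then have "lc (M (l x)) a = (\<Sum>b<k. T a b * x b)"
      using True by (simp add: lc_def M_def ell_less l_pred sum_L)
    moreover have "s (Suc a) (Suc b) * x b = (if a = b then x b else 0) + T a b * x b + s a b * x b" for b
      by (simp add: s_def algebra_simps)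
    then have "J (Y x) a = (\<Sum>b<k. (if a = b then x b else 0)) + (\<Sum>b<k. T a b * x b) + V x a"
      using True by (simp add: JY V_def sum.distrib)
    moreover have "t + v + (d + t + v) = d" for t v d :: 'a
    proof -
      have "t + v + (d + t + v) = d + ((t + t) + (v + v))" by (simp only: ac_simps)
      then show ?thesis by (simp add: char2_add_self[OF CHAR])
    qed
    ultimately show ?thesis using True by (simp add: I_def)
  qed (simp add: lc_def V_def JY I_def)
qed

lemma linears: "linear_fun E" "linear_fun M" "linear_fun l" "linear_fun g" "linear_fun lc" "linear_fun gc"
  "linear_fun V" "linear_fun Y" "linear_fun J" "linear_fun K"
proof -
  show "linear_fun E" "linear_fun lc" "linear_fun gc" "linear_fun J" "linear_fun K"
    by (auto simp: linear_fun_def fun_eq_iff E_def lc_def gc_def J_def K_def algebra_simps)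
  show "linear_fun M" "linear_fun l" "linear_fun g" "linear_fun V" "linear_fun Y"
    by (auto simp: linear_fun_def fun_eq_iff M_def l_def g_def V_def Y_def distrib_left sum.distrib
        sum_distrib_left mult.left_commute add_ac simp del: sum_of_bool_mult_eq sum_mult_of_bool_eq)
qed

sublocale coupled_grading E M l g lc gc V Y J K I
proof
  show "l (I w) = l w" for w by (auto simp: fun_eq_iff l_def I_def intro!: sum.cong)
  show "g (I w) = g w" for w by (auto simp: fun_eq_iff g_def I_def intro!: sum.cong)
  show "V (I w) = V w" for w by (auto simp: fun_eq_iff V_def I_def intro!: sum.cong)
  show "Y (I w) = Y w" for w by (auto simp: fun_eq_iff Y_def I_def intro!: sum.cong)
  show "K (Y w) = 0" for w by (auto simp: fun_eq_iff K_def Y_def s_def)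
  show "K (K w) = K w" for w using eps_cases by (auto simp: fun_eq_iff K_def)
  show "lc (l w) = I w" for w by (auto simp: fun_eq_iff lc_def l_ell I_def)
  show "gc (g w) = I w" for w by (auto simp: fun_eq_iff gc_def g_pred I_def)
  show "lc (g w) = 0" for w by (auto simp: fun_eq_iff lc_def g_L ell_L)
  show "gc (l w) = 0" for w by (auto simp: fun_eq_iff gc_def l_pred ell_less)
  show "E (E v) = E v" for v by (auto simp: fun_eq_iff E_def)
  show "J (I w) = J w" "K (I w) = K w" for w by (auto simp: fun_eq_iff J_def K_def I_def)
  show "I (lc v) = lc v" "I (gc v) = gc v" for v by (auto simp: fun_eq_iff I_def lc_def gc_def)
  show "I (V w) = V w" "I (Y w) = Y w" "I (J w) = J w" for w by (auto simp: fun_eq_iff I_def V_def Y_def J_def)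
  show "J (K w) = 0" for w by (auto simp: fun_eq_iff J_def K_def)
  show "v + v = 0" for v :: "nat \<Rightarrow> 'a" by (rule fun_add_self)
  show "E (v + v') = E v + E v'" "M (v + v') = M v + M v'" "l (v + v') = l v + l v'" "g (v + v') = g v + g v'"
    "lc (v + v') = lc v + lc v'" "gc (v + v') = gc v + gc v'" "V (v + v') = V v + V v'" "Y (v + v') = Y v + Y v'"
    "J (v + v') = J v + J v'" "K (v + v') = K v + K v'" for v v'
    by (rule linears[THEN linear_funD(1)])+
  show "E (l w) = l w" "E (g w) = 0" "lc (E w) = lc w" "gc (E w) = 0" "M (g w) = l w" for w
    by (rule E_l E_g lc_E gc_E M_g)+
  show "E (M (v + E v + g (gc v))) = M (v + E v + g (gc v))" "lc (M (v + E v + g (gc v))) = 0" 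
     "E (M (E v + l (lc v))) = 0" for v
    by (rule M_odd M_even)+
  show "V w = Y (J w) + K w" for w by (rule VYJ)
  show "lc (M (l w)) + V w + J (Y w) = I w" for w by (rule balance)
qed

lemma linear_R: "linear_fun R" and linear_E': "linear_fun E'" and linear_S: "linear_fun S"
proof -
  note linear_intros = linear_fun_add linears linears[THEN linear_fun_comp]
  have W: "linear_fun W" unfolding W_def[abs_def] gc'_def by (intro linear_intros)
  have gc': "linear_fun gc'" unfolding gc'_def[abs_def] by (intro linear_intros)
  have l': "linear_fun l'" unfolding l'_def[abs_def] by (intro linear_intros)
  have E': "linear_fun E'" unfolding E'_def[abs_def] by (intro linear_intros)
  have C: "linear_fun C" unfolding C_def[abs_def] using E' l' 
    by (intro linear_fun_add linear_fun_comp[OF E'] linear_fun_comp[OF linears(2)] linear_fun_comp[OF linears(4)] linears)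
  show R: "linear_fun R" unfolding R_def[abs_def]
    by (intro linear_fun_add linear_fun_comp[OF C] linear_fun_comp[OF linears(4)] linear_fun_comp[OF linears(10)] W gc')
  show "linear_fun S" unfolding S_def[abs_def] by (intro linear_fun_add linears R)
  show "linear_fun E'" by (rule E')
qed

lemma sum_of_three_idempotents_M: "sum_of_three_idempotents (2 * n) (mat_of_fun (2 * n) M)"
proof -
  let ?m = "mat_of_fun (2 * n)"
  have g0: "g x i = 0" if "2 * n \<le> i" for x i
    using that pred_less L by (intro g_notin) (auto simp: subset_iff, metis not_le)
  have E'0: "E' v i = 0" if "2 * n \<le> i" for v i using that g0 by (simp add: E'_def E_def)
  have R0: "R v i = 0" if "2 * n \<le> i" for v i using that g0 E'0 by (simp add: R_def C_def)
  have S0: "S v i = 0" if "2 * n \<le> i" for v i using that R0 by (simp add: S_def M_def)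
  have S: "?m M + ?m R = ?m S" by (simp add: S_def[abs_def] mat_of_fun_add)
  show ?thesis
  proof (rule sum_of_three_idempotents_odd[OF CHAR])
    show "?m E' * ?m E' = ?m E'"
      using mat_of_fun_comp[OF linear_E', of "2 * n" E'] E'0 E'_idem by simp
    show "?m R * ?m R = ?m R"
      using mat_of_fun_comp[OF linear_R, of "2 * n" R] R0 R_idem by simp
    have "?m S = ?m (\<lambda>v. E' (S v) + S (E' v))" by (rule arg_cong[of _ _ ?m]) (use S_odd in blast)
    also have "\<dots> = ?m E' * ?m S + ?m S * ?m E'"
      by (subst mat_of_fun_add) (simp add: mat_of_fun_comp linear_E' linear_S E'0 S0)
    finally show "?m M + ?m R = ?m E' * (?m M + ?m R) + (?m M + ?m R) * ?m E'" by (simp add: S)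
  qed simp_all
qed

end

section \<open>Changes of basis\<close>

lemma obtain_inverse_mat:
  fixes S :: "'a::field mat"
  assumes "S \<in> carrier_mat n n" "det S \<noteq> 0"
  obtains S' where "S' \<in> carrier_mat n n" "S * S' = 1\<^sub>m n" "S' * S = 1\<^sub>m n"
  using det_non_zero_imp_unit[OF assms, of "()"] that
  by (auto simp: Units_def ring_mat_def)

lemma det_mat_of_cols_basis:
  fixes bs :: "'a::field vec list"
  assumes "set bs \<subseteq> carrier_vec n" "length bs = n" "distinct bs" 
    and "\<not> module.lin_dep class_ring (module_vec TYPE('a) n) (set bs)"
  shows "det (mat_of_cols n bs) \<noteq> 0"
proof -
  interpret vec_space "TYPE('a)" n .
  have "cols (mat_of_cols n bs) = bs" using assms(1) by (simp add: cols_mat_of_cols)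
  then show ?thesis
    using lin_indpt_full_rank[of "mat_of_cols n bs" n] det_rank_iff[of "mat_of_cols n bs"] assms
      mat_of_cols_carrier(1)[of n bs] by auto
qed

lemma obtain_change_of_basis:
  fixes v :: "'a::field vec"
  assumes "v \<in> carrier_vec n" "v \<noteq> 0\<^sub>v n"
  obtains S S' where "S \<in> carrier_mat n n" "S' \<in> carrier_mat n n" "S * S' = 1\<^sub>m n" "S' * S = 1\<^sub>m n" "col S 0 = v"
proof -
  interpret vec_space "TYPE('a)" n .
  let ?bs = "basis_completion v" let ?S = "mat_of_cols n ?bs"
  note b = basis_completion[OF assms]
  have n: "n > 0" using assms by (auto intro: ccontr)
  have "det ?S \<noteq> 0" using b det_mat_of_cols_basis by blast
  moreover have S: "?S \<in> carrier_mat n n" using mat_of_cols_carrier(1)[of n ?bs] b(6) by simp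
  ultimately obtain S' where S': "S' \<in> carrier_mat n n" "?S * S' = 1\<^sub>m n" "S' * ?S = 1\<^sub>m n"
    using obtain_inverse_mat by blast
  have "?bs \<noteq> []" using b(6) n by auto
  then have "?bs ! 0 = v" using b(7) hd_conv_nth by metis
  then have "col ?S 0 = v" using b(6) n assms(1) by (simp add: col_mat_of_cols)
  then show ?thesis using that S S' by blast
qed

lemma trace_mat_comm:
  fixes P Q :: "'a::field mat"
  assumes "P \<in> carrier_mat n n" "Q \<in> carrier_mat n n"
  shows "trace_mat (P * Q) = trace_mat (Q * P)"
proof -
  have "trace_mat (P * Q) = (\<Sum>i<n. \<Sum>j<n. P $$ (i, j) * Q $$ (j, i))"
    using assms by (simp add: trace_mat_def scalar_prod_def atLeast0LessThan)
  also have "\<dots> = (\<Sum>j<n. \<Sum>i<n. Q $$ (j, i) * P $$ (i, j))"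
    by (subst sum.swap) (simp add: mult.commute)
  also have "\<dots> = trace_mat (Q * P)"
    using assms by (simp add: trace_mat_def scalar_prod_def atLeast0LessThan)
  finally show ?thesis .
qed

lemma trace_mat_similar:
  fixes X Z :: "'a::field mat"
  assumes "similar_mat X Z" shows "trace_mat X = trace_mat Z"
proof -
  obtain n P Q where w: "{X, Z, P, Q} \<subseteq> carrier_mat n n" "P * Q = 1\<^sub>m n" "Q * P = 1\<^sub>m n" "X = P * Z * Q"
    using similar_matD[OF assms] by blast
  have "trace_mat X = trace_mat (Q * (P * Z))"
    unfolding w(4) using w(1) by (intro trace_mat_comm[of _ n]) auto
  also have "Q * (P * Z) = (Q * P) * Z" using w(1) by (simp add: assoc_mult_mat[of _ n n _ n _ n])
  also have "\<dots> = Z" using w(1,3) left_mult_one_mat[of Z n n] by auto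
  finally show ?thesis .
qed

section \<open>Krylov bases\<close>

context vec_space begin

text \<open>Built greedily: the image of the last vector is appended if it is independent of the list, and
otherwise any vector outside the span is.\<close>

lemma krylov_basis:
  assumes B: "B \<in> carrier_mat n n" and "m \<le> n"
  shows "\<exists>bs. set bs \<subseteq> carrier_vec n \<and> length bs = m \<and> distinct bs \<and> lin_indpt (set bs) \<and>
    (\<forall>i. Suc i < m \<longrightarrow> bs ! Suc i = B *\<^sub>v (bs ! i) \<or> B *\<^sub>v (bs ! i) \<in> span (set (take (Suc i) bs)))"
  using \<open>m \<le> n\<close>
proof (induction m)
  case 0
  show ?case using finite_lin_indpt2 by (intro exI[of _ "[]"]) (auto simp: lin_dep_def)
next
  case (Suc m)
  then obtain bs where bs: "set bs \<subseteq> carrier_vec n" "length bs = m" "distinct bs" "lin_indpt (set bs)"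
    "\<And>i. Suc i < m \<Longrightarrow> bs ! Suc i = B *\<^sub>v (bs ! i) \<or> B *\<^sub>v (bs ! i) \<in> span (set (take (Suc i) bs))"
    by auto
  have step: "\<exists>v \<in> carrier_vec n. v \<notin> span (set bs) \<and> 
    (0 < m \<longrightarrow> v = B *\<^sub>v (bs ! (m - 1)) \<or> B *\<^sub>v (bs ! (m - 1)) \<in> span (set bs))"
  proof (cases "0 < m \<and> B *\<^sub>v (bs ! (m - 1)) \<notin> span (set bs)")
    case True
    then have "B *\<^sub>v (bs ! (m - 1)) \<in> carrier_vec n"
      using bs(1,2) nth_mem[of "m - 1" bs] by (intro mult_mat_vec_carrier[OF B]) auto
    then show ?thesis using True by blast
  next
    case False
    have "span (set bs) \<noteq> carrier_vec n"
    proof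
      assume "span (set bs) = carrier_vec n"
      then have "dim \<le> card (set bs)"
        using bs(1) by (intro gen_ge_dim) auto
      then show False using bs(2) Suc.prems card_length[of bs] dim_is_n by simp
    qed
    moreover have "span (set bs) \<subseteq> carrier_vec n" using span_closed[OF bs(1)] by auto
    ultimately show ?thesis using False by blast
  qed
  then obtain v where v: "v \<in> carrier_vec n" "v \<notin> span (set bs)"
    "0 < m \<Longrightarrow> v = B *\<^sub>v (bs ! (m - 1)) \<or> B *\<^sub>v (bs ! (m - 1)) \<in> span (set bs)" by blast
  have "v \<notin> set bs" using v(2) bs(1) span_mem by blast
  then have "lin_indpt (insert v (set bs))"
    using lin_dep_iff_in_span[OF _ bs(4) v(1)] bs(1) v(2) by simp
  moreover have "(bs @ [v]) ! Suc i = B *\<^sub>v ((bs @ [v]) ! i) \<or> 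
      B *\<^sub>v ((bs @ [v]) ! i) \<in> span (set (take (Suc i) (bs @ [v])))" if "Suc i < Suc m" for i
  proof (cases "Suc i < m")
    case True then show ?thesis using bs(2) bs(5)[of i] by (simp add: nth_append)
  next
    case False
    then have "m = Suc i" using that by simp
    then show ?thesis using bs(2) v(3) by (auto simp: nth_append)
  qed
  ultimately show ?case using bs v \<open>v \<notin> set bs\<close> by (intro exI[of _ "bs @ [v]"]) auto
qed

lemma span_take_coordinates:
  assumes bs: "set bs \<subseteq> carrier_vec n" and x: "x \<in> span (set (take m bs))"
  shows "\<exists>c \<in> carrier_vec (length bs). x = mat_of_cols n bs *\<^sub>v c \<and> (\<forall>i < length bs. m \<le> i \<longrightarrow> c $ i = 0)"
proof -
  let ?ts = "take m bs"
  have ts: "set ?ts \<subseteq> carrier_vec n" using bs set_take_subset by fast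
  then obtain c where "x = lincomb_list c ?ts"
    using x span_list_as_span[OF ts] unfolding span_list_def by auto
  then have x': "x = mat_of_cols n ?ts *\<^sub>v vec (length ?ts) c"
    using ts lincomb_list_as_mat_mult[of ?ts] by fastforce
  define d where "d = vec (length bs) (\<lambda>i. if i < m then c i else 0)"
  have "x = mat_of_cols n bs *\<^sub>v d"
  proof (rule eq_vecI)
    fix i assume "i < dim_vec (mat_of_cols n bs *\<^sub>v d)"
    then have i: "i < n" by simp
    have "x $ i = (\<Sum>j<length ?ts. ?ts ! j $ i * c j)"
      using i by (simp add: x' scalar_prod_def mat_of_cols_def atLeast0LessThan)
    also have "\<dots> = (\<Sum>j<length bs. bs ! j $ i * d $ j)"
      by (rule sum.mono_neutral_cong_left) (auto simp: d_def)
    also have "\<dots> = (mat_of_cols n bs *\<^sub>v d) $ i"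
      using i by (simp add: d_def scalar_prod_def mat_of_cols_def atLeast0LessThan)
    finally show "x $ i = (mat_of_cols n bs *\<^sub>v d) $ i" .
  qed (simp add: x')
  then show ?thesis by (intro bexI[of _ d]) (auto simp: d_def)
qed

end

text \<open>The matrix of \<open>B\<close> in a Krylov basis; \<open>L\<close> collects the positions at which the greedy construction had to
choose a fresh vector, and the last position.\<close>

lemma hessenberg_form:
  fixes B :: "'a::field mat"
  assumes B: "B \<in> carrier_mat n n"
  obtains H L where "H \<in> carrier_mat n n" "similar_mat B H" "L \<subseteq> {..<n}"
    "\<And>j. j < n \<Longrightarrow> j \<notin> L \<Longrightarrow> Suc j < n"
    "\<And>i j. i < n \<Longrightarrow> j < n \<Longrightarrow> j \<notin> L \<Longrightarrow> H $$ (i, j) = (if i = Suc j then 1 else 0)"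
    "\<And>i j. j \<in> L \<Longrightarrow> j < i \<Longrightarrow> i < n \<Longrightarrow> H $$ (i, j) = 0"
proof -
  interpret vec_space "TYPE('a)" n .
  obtain bs where bs: "set bs \<subseteq> carrier_vec n" "length bs = n" "distinct bs" "lin_indpt (set bs)"
    "\<And>i. Suc i < n \<Longrightarrow> bs ! Suc i = B *\<^sub>v (bs ! i) \<or> B *\<^sub>v (bs ! i) \<in> span (set (take (Suc i) bs))"
    using krylov_basis[OF B order_refl] by blast
  define S where "S = mat_of_cols n bs"
  have S: "S \<in> carrier_mat n n" using mat_of_cols_carrier(1)[of n bs] by (simp add: S_def bs(2))
  have col_S: "col S j = bs ! j" if "j < n" for j
    using that bs(1,2) unfolding S_def by (intro col_mat_of_cols) auto
  have "det S \<noteq> 0" unfolding S_def using bs(1-4) by (rule det_mat_of_cols_basis)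
  then obtain S' where S': "S' \<in> carrier_mat n n" "S * S' = 1\<^sub>m n" "S' * S = 1\<^sub>m n"
    using obtain_inverse_mat[OF S] by blast
  define H where "H = S' * (B * S)"
  have H: "H \<in> carrier_mat n n" using S S' B by (simp add: H_def)
  have sim: "similar_mat B H"
  proof (rule similar_matI[of _ _ S S' n])
    have "S * H * S' = (S * S') * B * (S * S')"
      using S S'(1) B by (simp add: H_def assoc_mult_mat[of _ n n _ n _ n])
    then show "B = S * H * S'" using S' B by simp
  qed (use S S' B H in auto)
  define L where "L = {j. j < n \<and> \<not> (Suc j < n \<and> bs ! Suc j = B *\<^sub>v (bs ! j))}"
  have H_col: "H $$ (i, j) = c $ i"
    if "i < n" "j < n" "c \<in> carrier_vec n" "B *\<^sub>v (bs ! j) = S *\<^sub>v c" for i j c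
  proof -
    have "col H j = S' *\<^sub>v col (B * S) j"
      unfolding H_def using that S S' B by (intro col_mult2) auto
    also have "col (B * S) j = B *\<^sub>v col S j" using that S B by (intro col_mult2) auto
    also have "S' *\<^sub>v (B *\<^sub>v col S j) = S' *\<^sub>v (S *\<^sub>v c)" using that by (simp add: col_S)
    also have "\<dots> = (S' * S) *\<^sub>v c" using that(3) S S'(1) by (intro assoc_mult_mat_vec[symmetric]) auto
    also have "\<dots> = c" using that(3) S'(3) by simp
    finally have "col H j $ i = c $ i" by simp
    then show ?thesis using that H by simp
  qed
  show ?thesis
  proof (rule that[OF H sim, of L])
    show "Suc j < n" if "j < n" "j \<notin> L" for j using that by (auto simp: L_def)
    show "H $$ (i, j) = (if i = Suc j then 1 else 0)" if "i < n" "j < n" "j \<notin> L" for i j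
    proof -
      have j: "Suc j < n" "B *\<^sub>v (bs ! j) = bs ! Suc j" using that by (auto simp: L_def)
      have "S *\<^sub>v unit_vec n (Suc j) = col S (Suc j)" 
        using j(1) S by (intro eq_vecI) auto
      then have "B *\<^sub>v (bs ! j) = S *\<^sub>v unit_vec n (Suc j)" using j col_S by simp
      then have "H $$ (i, j) = unit_vec n (Suc j) $ i" using that(1,2) by (intro H_col) simp_all
      then show ?thesis using that(1) j(1) by simp
    qed
    show "H $$ (i, j) = 0" if "j \<in> L" "j < i" "i < n" for i j
    proof -
      have j: "j < n" using that by simp
      have "B *\<^sub>v (bs ! j) \<in> span (set (take (Suc j) bs))"
        using bs(5)[of j] that by (auto simp: L_def)
      then obtain c where "c \<in> carrier_vec n" "B *\<^sub>v (bs ! j) = S *\<^sub>v c" "\<And>i. i < n \<Longrightarrow> Suc j \<le> i \<Longrightarrow> c $ i = 0"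
        using span_take_coordinates[OF bs(1)] unfolding bs(2) S_def[symmetric] by blast
      then show ?thesis using H_col[of i j c] j that by simp
    qed
  qed (auto simp: L_def)
qed

section \<open>Invertible matrices\<close>

text \<open>Conjugation by the unipotent block matrix \<open>[[1, Y], [0, 1]]\<close>: an upper right block can be created freely
as long as its columns lie in the column space of \<open>H\<close>.\<close>

lemma similar_pad:
  fixes H Y :: "'a::field mat"
  assumes H: "H \<in> carrier_mat n n" and Y: "Y \<in> carrier_mat n m"
  shows "similar_mat (four_block_mat H (0\<^sub>m n m) (0\<^sub>m m n) (0\<^sub>m m m)) (four_block_mat H (H * Y) (0\<^sub>m m n) (0\<^sub>m m m))"
    (is "similar_mat ?M ?M'")
proof -
  let ?T = "\<lambda>X. four_block_mat (1\<^sub>m n) X (0\<^sub>m m n) (1\<^sub>m m)"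
  have id: "?T X * ?T Y = ?T (Y + X)" if "X \<in> carrier_mat n m" "Y \<in> carrier_mat n m" for X Y :: "'a mat"
    using that by (subst mult_four_block_mat[of _ n n _ m _ m _ _ n _ m]) simp_all
  have uminus_Y: "- Y \<in> carrier_mat n m" using Y by simp
  have neg: "Y + - Y = 0\<^sub>m n m" "- Y + Y = 0\<^sub>m n m" using Y by (auto intro!: eq_matI)
  have one: "?T (0\<^sub>m n m) = 1\<^sub>m (n + m)" by simp
  have HY: "H * Y \<in> carrier_mat n m" using assms by simp
  have neg': "- (H * Y) + H * Y = 0\<^sub>m n m" "- (0\<^sub>m m m :: 'a mat) = 0\<^sub>m m m"
    using HY by (auto intro!: eq_matI)
  have TM: "?T Y * ?M' = ?M'"
    using H Y HY by (subst mult_four_block_mat[of _ n n _ m _ m _ _ n _ m]) simp_all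
  have MT: "?M' * ?T (- Y) = ?M"
    using H Y HY by (subst mult_four_block_mat[of _ n n _ m _ m _ _ n _ m]) (simp_all add: neg')
  show ?thesis
  proof (rule similar_matI[of _ _ "?T Y" "?T (- Y)" "n + m"])
    show "?T Y * ?T (-Y) = 1\<^sub>m (n + m)" "?T (-Y) * ?T Y = 1\<^sub>m (n + m)"
      unfolding id[OF Y uminus_Y] id[OF uminus_Y Y] neg one by (rule refl)+
    show "?M = ?T Y * ?M' * ?T (- Y)" by (simp only: TM MT)
  qed (use H Y HY in auto)
qed

text \<open>Invertibility is needed so that the starts of the chains lie in the column space of the Hessenberg
form and can be made images of pads.\<close>

lemma sum_of_three_idempotents_pad_invertible:
  fixes B :: "'a::field mat"
  assumes char2: "CHAR('a) = 2" and B: "B \<in> carrier_mat n n" and det: "det B \<noteq> 0"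
    and trace: "trace_mat B \<in> {0, 1}"
  shows "sum_of_three_idempotents (n + n) (four_block_mat B (0\<^sub>m n n) (0\<^sub>m n n) (0\<^sub>m n n))"
proof -
  obtain H L where H: "H \<in> carrier_mat n n" and sim: "similar_mat B H" and HL: "L \<subseteq> {..<n}"
    "\<And>j. j < n \<Longrightarrow> j \<notin> L \<Longrightarrow> Suc j < n"
    "\<And>i j. i < n \<Longrightarrow> j < n \<Longrightarrow> j \<notin> L \<Longrightarrow> H $$ (i, j) = (if i = Suc j then 1 else 0)"
    "\<And>i j. j \<in> L \<Longrightarrow> j < i \<Longrightarrow> i < n \<Longrightarrow> H $$ (i, j) = 0"
    using hessenberg_form[OF B] by blast
  have "(\<Sum>j\<in>L. H $$ (j, j)) = trace_mat H"
    using H HL(1,3) unfolding trace_mat_def by (intro sum.mono_neutral_left) auto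
  then have "(\<Sum>j\<in>L. H $$ (j, j)) \<in> {0, 1}" using trace trace_mat_similar[OF sim] by simp
  then interpret hessenberg n H L
    using char2 HL by unfold_locales auto
  have "det H \<noteq> 0" using det det_similar[OF sim] by simp
  then obtain H' where H': "H' \<in> carrier_mat n n" "H * H' = 1\<^sub>m n" using obtain_inverse_mat[OF H] by blast
  \<comment> \<open>the column of a chain start is the corresponding unit vector, all others are 0\<close>
  define F :: "'a mat" where "F = mat n n (\<lambda>(i, j). if i = j \<and> pred i = n + i then 1 else 0)"
  have F: "F \<in> carrier_mat n n" by (simp add: F_def)
  have "H * (H' * F) = F" using H H' F by (simp add: assoc_mult_mat[of _ n n _ n _ n, symmetric])
  then have "similar_mat (four_block_mat H (0\<^sub>m n n) (0\<^sub>m n n) (0\<^sub>m n n)) (four_block_mat H F (0\<^sub>m n n) (0\<^sub>m n n))"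
    using similar_pad[OF H, of "H' * F" n] H'(1) F by simp
  moreover have "similar_mat (four_block_mat B (0\<^sub>m n n) (0\<^sub>m n n) (0\<^sub>m n n)) (four_block_mat H (0\<^sub>m n n) (0\<^sub>m n n) (0\<^sub>m n n))"
    using sim B by (intro similar_mat_four_block_0_0 similar_mat_refl) auto
  moreover have "four_block_mat H F (0\<^sub>m n n) (0\<^sub>m n n) = mat_of_fun (2 * n) M"
  proof (rule eq_matI)
    fix i j assume "i < dim_row (mat_of_fun (2 * n) M)" "j < dim_col (mat_of_fun (2 * n) M)"
    then have ij: "i < 2 * n" "j < 2 * n" by (auto simp: mat_of_fun_def)
    have sum: "(\<Sum>m\<in>L. H $$ (i, m) * unit_fun j m) = (if j \<in> L then H $$ (i, j) else 0)"
    proof -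
      have "(\<Sum>m\<in>L. H $$ (i, m) * unit_fun j m) = (\<Sum>m\<in>L. if j = m then H $$ (i, m) else 0)"
        by (rule sum.cong) (auto simp: unit_fun_def)
      then show ?thesis using finite_L by simp
    qed
    have pred: "pred i = j \<longleftrightarrow> i = Suc j \<and> j \<notin> L" if "j < n" "i < n"
      using that by (auto simp: pred_def split: if_splits)
    have pred': "pred i = j \<longleftrightarrow> i = j - n \<and> pred i = n + i" if "i < n" "n \<le> j"
      using that by (auto simp: pred_def split: if_splits)
    show "four_block_mat H F (0\<^sub>m n n) (0\<^sub>m n n) $$ (i, j) = mat_of_fun (2 * n) M $$ (i, j)"
    proof (cases "i < n")
      case True
      then have "mat_of_fun (2 * n) M $$ (i, j) = (if pred i = j then 1 else 0) + (if j \<in> L then H $$ (i, j) else 0)"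
        using ij by (simp add: mat_of_fun_def M_def sum) (simp add: unit_fun_def)
      then show ?thesis
        using True ij H F HL(1) HL(3)[of i j] pred pred' by (cases "j < n") (auto simp: F_def)
    next
      case False
      then show ?thesis using ij H F by (simp add: mat_of_fun_def M_def)
    qed
  qed (use H F in \<open>auto simp: mat_of_fun_def\<close>)
  ultimately have "similar_mat (four_block_mat B (0\<^sub>m n n) (0\<^sub>m n n) (0\<^sub>m n n)) (mat_of_fun (2 * n) M)"
    by (metis similar_mat_trans)
  from sum_of_three_idempotents_similar[OF this _ sum_of_three_idempotents_M] show ?thesis
    using four_block_carrier_mat[OF B zero_carrier_mat] by (simp only: mult_2)
qed

section \<open>Nilpotent matrices\<close>

text \<open>Such a matrix is odd for the grading by the parity of the index, so the third idempotent can be 0.\<close>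

lemma sum_of_three_idempotents_superdiagonal:
  fixes X :: "'a::field mat"
  assumes char2: "CHAR('a) = 2" and X: "X \<in> carrier_mat N N"
    and sup: "\<And>i j. i < N \<Longrightarrow> j < N \<Longrightarrow> j \<noteq> Suc i \<Longrightarrow> X $$ (i, j) = 0"
  shows "sum_of_three_idempotents N X"
proof -
  define E :: "'a mat" where "E = mat N N (\<lambda>(i, j). if i = j \<and> even i then 1 else 0)"
  have E [simp]: "E \<in> carrier_mat N N" by (simp add: E_def)
  have EZ: "(E * Z) $$ (i, j) = (if even i then Z $$ (i, j) else 0)"
    if "Z \<in> carrier_mat N N" "i < N" "j < N" for Z i j
  proof -
    have "(E * Z) $$ (i, j) = (\<Sum>m<N. (if i = m \<and> even i then 1 else 0) * Z $$ (m, j))"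
      using that by (simp add: E_def scalar_prod_def atLeast0LessThan)
    also have "\<dots> = (\<Sum>m<N. if i = m then (if even i then Z $$ (m, j) else 0) else 0)"
      by (rule sum.cong) auto
    finally show ?thesis using that by simp
  qed
  have ZE: "(Z * E) $$ (i, j) = (if even j then Z $$ (i, j) else 0)"
    if "Z \<in> carrier_mat N N" "i < N" "j < N" for Z i j
  proof -
    have "(Z * E) $$ (i, j) = (\<Sum>m<N. Z $$ (i, m) * (if m = j \<and> even m then 1 else 0))"
      using that by (simp add: E_def scalar_prod_def atLeast0LessThan)
    also have "\<dots> = (\<Sum>m<N. if m = j then (if even j then Z $$ (i, m) else 0) else 0)"
      by (rule sum.cong) auto
    finally show ?thesis using that by simp
  qed
  have E_diag: "(if even i then E $$ (i, j) else 0) = E $$ (i, j)" if "i < N" "j < N" for i j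
    using that by (simp add: E_def)
  have "E * E = E"
    by (rule eq_matI) (auto simp: EZ E_diag carrier_matD[OF E] simp del: index_mult_mat(1))
  moreover have "X $$ (i, j) = 0" if "i < N" "j < N" "even i = even j" for i j
    using that by (intro sup) auto
  then have "X = E * X + X * E"
    using X by (intro eq_matI) (auto simp: EZ ZE carrier_matD[OF E] simp del: index_mult_mat(1))
  ultimately show ?thesis
    using sum_of_three_idempotents_odd[OF char2 X E zero_carrier_mat] X by simp
qed

lemma jordan_matrix_nilpotent_entry:
  assumes "\<And>m a. (m, a) \<in> set nas \<Longrightarrow> a = (0::'a::field)"
    and "i < sum_list (map fst nas)" "j < sum_list (map fst nas)" "j \<noteq> Suc i"
  shows "jordan_matrix nas $$ (i, j) = 0"
  using assms
proof (induction nas arbitrary: i j)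
  case (Cons x nas)
  obtain m a where x: "x = (m, a)" by (cases x)
  have "a = 0" using Cons.prems(1)[of m a] x by simp
  show ?case
  proof (cases "i < m \<or> j < m")
    case True
    then show ?thesis using Cons.prems(2-4) \<open>a = 0\<close> by (auto simp: x jordan_matrix_Cons)
  next
    case False
    then have "jordan_matrix nas $$ (i - m, j - m) = 0"
    proof (intro Cons.IH)
      show "b = 0" if "(k, b) \<in> set nas" for k b using that by (intro Cons.prems(1)[of k]) simp
    qed (use Cons.prems(2-4) False x in auto)
    then show ?thesis using False Cons.prems(2-4) by (simp add: x jordan_matrix_Cons)
  qed
qed simp

text \<open>The only eigenvalue is 0, so the Jordan form has entries on the superdiagonal only.\<close>

lemma sum_of_three_idempotents_strictly_upper:
  fixes U :: "'a::field mat"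
  assumes char2: "CHAR('a) = 2" and U: "U \<in> carrier_mat n n"
    and upper: "\<And>i j. i < n \<Longrightarrow> j \<le> i \<Longrightarrow> U $$ (i, j) = 0"
  shows "sum_of_three_idempotents n U"
proof -
  have ut: "upper_triangular U" using U upper by (auto simp: upper_triangular_def)
  obtain nas where nas: "jordan_nf U nas" using triangular_to_jnf_vector[OF U ut] by blast
  let ?J = "jordan_matrix nas"
  have sim: "similar_mat U ?J" and pos: "0 \<notin> fst ` set nas" using nas by (auto simp: jordan_nf_def)
  have zero: "a = 0" if "(m, a) \<in> set nas" for m a
  proof -
    have "m \<noteq> 0" using pos that by force
    have "[:- a, 1:] ^ m dvd char_poly U"
      unfolding jordan_nf_char_poly[OF nas] using that by (intro prod_list_dvd) force
    then have "[:- a, 1:] dvd char_poly U" using \<open>m \<noteq> 0\<close> by (meson dvd_power dvd_trans gr0I)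
    then have "poly (char_poly U) a = 0" by (simp add: poly_eq_0_iff_dvd)
    moreover have "diag_mat U = replicate n 0" 
      using U upper by (auto simp: diag_mat_def intro!: nth_equalityI)
    then have "char_poly U = [:0, 1:] ^ n"
      by (simp add: char_poly_upper_triangular[OF U ut])
    ultimately show ?thesis by (simp add: poly_power)
  qed
  have dim: "sum_list (map fst nas) = n"
    using similar_matD[OF sim] U by (metis carrier_matD(1) insert_subset jordan_matrix_dim(1))
  have "sum_of_three_idempotents n ?J"
    using jordan_matrix_carrier[of nas] dim jordan_matrix_nilpotent_entry[OF zero]
    by (intro sum_of_three_idempotents_superdiagonal[OF char2]) auto
  then show ?thesis using sum_of_three_idempotents_similar[OF sim U] by simp
qed

section \<open>Splitting off the nilpotent part\<close>

text \<open>Used with \<open>X * D\<close> equal to the part of the row \<open>B\<close> that is to be removed.\<close>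

lemma similar_shear:
  fixes B X D :: "'a::field mat"
  assumes B: "B \<in> carrier_mat 1 m" and D: "D \<in> carrier_mat m m" and X: "X \<in> carrier_mat 1 m"
  shows "similar_mat (four_block_mat (0\<^sub>m 1 1) B (0\<^sub>m m 1) D) (four_block_mat (0\<^sub>m 1 1) (B - X * D) (0\<^sub>m m 1) D)"
    (is "similar_mat ?M ?M'")
proof -
  let ?T = "\<lambda>X. four_block_mat (1\<^sub>m 1) X (0\<^sub>m m 1) (1\<^sub>m m)"
  have id: "?T X * ?T Y = ?T (Y + X)" if "X \<in> carrier_mat 1 m" "Y \<in> carrier_mat 1 m" for X Y :: "'a mat"
    using that by (subst mult_four_block_mat[of _ 1 1 _ m _ m _ _ 1 _ m])  simp_all
  have one: "?T (0\<^sub>m 1 m) = 1\<^sub>m (1 + m)" using four_block_one_mat[of 1 m] by simp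
  have TX: "?T X * ?M' = ?M"
  proof -
    have XD: "X * D \<in> carrier_mat 1 m" using X D by simp
    have "B - Z + Z = B" if "Z \<in> carrier_mat 1 m" for Z using B that by (intro eq_matI) auto
    from this[OF XD] show ?thesis using assms XD
      by (subst mult_four_block_mat[of _ 1 1 _ m _ m _ _ 1 _ m]) auto
  qed
  have MT: "?M * ?T (-X) = ?M"
    using assms by (subst mult_four_block_mat[of _ 1 1 _ m _ m _ _ 1 _ m]) auto
  have uminus_X: "- X \<in> carrier_mat 1 m" using X by simp
  have neg: "X + - X = 0\<^sub>m 1 m" "- X + X = 0\<^sub>m 1 m" using X by (auto intro!: eq_matI)
  show ?thesis
  proof (rule similar_matI[of _ _ "?T X" "?T (-X)" "1 + m"])
    show "?T X * ?T (-X) = 1\<^sub>m (1 + m)" "?T (-X) * ?T X = 1\<^sub>m (1 + m)"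
      unfolding id[OF X uminus_X] id[OF uminus_X X] neg one by (rule refl)+
    show "?M = ?T X * ?M' * ?T (-X)" by (simp only: TX MT)
  qed (use assms in \<open>auto intro!: four_block_carrier_mat\<close>)
qed

text \<open>The Fitting decomposition, with the nilpotent part in strictly triangular form. As long as the matrix
is singular, a kernel vector is made the first basis vector. This leaves a row above the remaining block;
over the nilpotent part the row may stay, and over the invertible part it is removed by a shear.\<close>

lemma fitting_decomposition:
  fixes A :: "'a::field mat"
  assumes "A \<in> carrier_mat n n"
  shows "\<exists>a b U B. n = a + b \<and> U \<in> carrier_mat a a \<and> B \<in> carrier_mat b b \<and>
    similar_mat A (four_block_mat U (0\<^sub>m a b) (0\<^sub>m b a) B) \<and>
    (\<forall>i<a. \<forall>j\<le>i. U $$ (i, j) = 0) \<and> det B \<noteq> 0"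
  using assms
proof (induction n arbitrary: A)
  case 0
  then have "A = four_block_mat (0\<^sub>m 0 0) (0\<^sub>m 0 0) (0\<^sub>m 0 0) A" by (intro eq_matI) auto
  moreover have "similar_mat A A" using 0 by (rule similar_mat_refl)
  ultimately show ?case using 0 
    by (intro exI[of _ 0] exI[of _ "0\<^sub>m 0 0"] exI[of _ A]) auto
next
  case (Suc m)
  show ?case
  proof (cases "det A = 0")
    case False
    have "A = four_block_mat (0\<^sub>m 0 0) (0\<^sub>m 0 (Suc m)) (0\<^sub>m (Suc m) 0) A" 
      using Suc.prems by (intro eq_matI) auto
    moreover have "similar_mat A A" using Suc.prems by (rule similar_mat_refl)
    ultimately show ?thesis using Suc.prems False
      by (intro exI[of _ 0] exI[of _ "Suc m"] exI[of _ "0\<^sub>m 0 0"] exI[of _ A]) auto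
  next
    case True
    then obtain v where v: "v \<in> carrier_vec (Suc m)" "v \<noteq> 0\<^sub>v (Suc m)" "A *\<^sub>v v = 0\<^sub>v (Suc m)"
      using det_0_iff_vec_prod_zero_field[OF Suc.prems] by auto
    obtain S S' where S: "S \<in> carrier_mat (Suc m) (Suc m)" "S' \<in> carrier_mat (Suc m) (Suc m)" 
      "S * S' = 1\<^sub>m (Suc m)" "S' * S = 1\<^sub>m (Suc m)" "col S 0 = v"
      using obtain_change_of_basis[OF v(1,2)] by blast
    define C where "C = S' * (A * S)"
    have C: "C \<in> carrier_mat (1 + m) (1 + m)" using S Suc.prems by (simp add: C_def)
    have sim: "similar_mat A C"
    proof (rule similar_matI[of _ _ S S' "Suc m"])
      have "S * C * S' = (S * S') * A * (S * S')"
        using S(1,2) Suc.prems by (simp add: C_def assoc_mult_mat[of _ "Suc m" "Suc m" _ "Suc m" _ "Suc m"])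
      then show "A = S * C * S'" using S Suc.prems by simp
    qed (use S Suc.prems C in auto)
    have "col (A * S) 0 = A *\<^sub>v col S 0" using S(1) Suc.prems by (intro col_mult2) auto
    then have AS0: "col (A * S) 0 = 0\<^sub>v (Suc m)" using S(5) v(3) by simp
    have C0: "C $$ (i, 0) = 0" if "i < Suc m" for i
    proof -
      have "C $$ (i, 0) = row S' i \<bullet> col (A * S) 0" using that S Suc.prems by (simp add: C_def)
      then show ?thesis using AS0 S(2) that by simp
    qed
    define r where "r = mat 1 m (\<lambda>(i, j). C $$ (i, Suc j))"
    define A' where "A' = mat m m (\<lambda>(i, j). C $$ (Suc i, Suc j))"
    have A': "A' \<in> carrier_mat m m" and r: "r \<in> carrier_mat 1 m" by (simp_all add: A'_def r_def)
    have C_block: "C = four_block_mat (0\<^sub>m 1 1) r (0\<^sub>m m 1) A'"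
      using C C0 by (intro eq_matI) (auto simp: r_def A'_def)
    obtain a b U B where IH: "m = a + b" "U \<in> carrier_mat a a" "B \<in> carrier_mat b b"
      "similar_mat A' (four_block_mat U (0\<^sub>m a b) (0\<^sub>m b a) B)"
      "\<And>i j. i < a \<Longrightarrow> j \<le> i \<Longrightarrow> U $$ (i, j) = 0" "det B \<noteq> 0"
      using Suc.IH[OF A'] by blast
    define D where "D = four_block_mat U (0\<^sub>m a b) (0\<^sub>m b a) B"
    have D: "D \<in> carrier_mat m m" using IH by (simp add: D_def)
    have "similar_mat (0\<^sub>m 1 1 :: 'a mat) (0\<^sub>m 1 1)" by (rule similar_mat_refl[of _ 1]) simp
    then have "\<exists>R. R \<in> carrier_mat 1 m \<and> similar_mat C (four_block_mat (0\<^sub>m 1 1) R (0\<^sub>m m 1) D)"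
      unfolding C_block by (rule similar_mat_four_block_0_ex[OF _ IH(4)[folded D_def] r zero_carrier_mat A'])
    then obtain R where R: "R \<in> carrier_mat 1 m" "similar_mat C (four_block_mat (0\<^sub>m 1 1) R (0\<^sub>m m 1) D)"
      by (elim exE conjE)
    obtain B' where B': "B' \<in> carrier_mat b b" "B' * B = 1\<^sub>m b" using obtain_inverse_mat[OF IH(3,6)] by blast
    define r1 r2 where "r1 = mat 1 a (\<lambda>(i, j). R $$ (i, j))" and "r2 = mat 1 b (\<lambda>(i, j). R $$ (i, a + j))"
    have r12: "r1 \<in> carrier_mat 1 a" "r2 \<in> carrier_mat 1 b" by (simp_all add: r1_def r2_def)
    \<comment> \<open>the shear whose product with the invertible block \<open>B\<close> is the row \<open>r2\<close> above it\<close>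
    define x where "x = r2 * B'"
    define X where "X = mat 1 m (\<lambda>(i, j). if j < a then 0 else x $$ (i, j - a))"
    have X: "X \<in> carrier_mat 1 m" by (simp add: X_def)
    have "x * B = r2" using r12 B' IH(3) by (simp add: x_def assoc_mult_mat[of _ 1 b _ b _ b])
    define X0 where "X0 = four_block_mat (0\<^sub>m 1 a) x (0\<^sub>m 0 a) (0\<^sub>m 0 b)"
    have "X = X0" using r12 B' IH(1) by (intro eq_matI) (auto simp: X_def X0_def x_def)
    then have "X * D = four_block_mat (0\<^sub>m 1 a) r2 (0\<^sub>m 0 a) (0\<^sub>m 0 b)"
      using IH r12 B' \<open>x * B = r2\<close> 
      by (simp add: X0_def D_def mult_four_block_mat[of _ 1 a _ b _ 0 _ _ a _ b] x_def) 
    then have RX: "(R - X * D) $$ (0, j) = (if j < a then r1 $$ (0, j) else 0)" if "j < m" for j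
      using that IH(1) R(1) r12 by (auto simp: r1_def r2_def)
    define U' where "U' = four_block_mat (0\<^sub>m 1 1) r1 (0\<^sub>m a 1) U"
    have "four_block_mat (0\<^sub>m 1 1) (R - X * D) (0\<^sub>m m 1) D = four_block_mat U' (0\<^sub>m (Suc a) b) (0\<^sub>m b (Suc a)) B"
    proof (rule eq_matI)
      fix i j
      assume "i < dim_row (four_block_mat U' (0\<^sub>m (Suc a) b) (0\<^sub>m b (Suc a)) B)"
        "j < dim_col (four_block_mat U' (0\<^sub>m (Suc a) b) (0\<^sub>m b (Suc a)) B)"
      then have ij: "i < Suc m" "j < Suc m" using IH r12 by (auto simp: U'_def)
      show "four_block_mat (0\<^sub>m 1 1) (R - X * D) (0\<^sub>m m 1) D $$ (i, j) = 
        four_block_mat U' (0\<^sub>m (Suc a) b) (0\<^sub>m b (Suc a)) B $$ (i, j)"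
        using ij IH(1-3) r12 R(1) D X RX
        by (cases i; cases j) (auto simp: U'_def D_def simp del: index_minus_mat)
    qed (use IH r12 D in \<open>auto simp: U'_def\<close>)
    then have "similar_mat A (four_block_mat U' (0\<^sub>m (Suc a) b) (0\<^sub>m b (Suc a)) B)"
      using sim R(2) similar_shear[OF R(1) D X] by (metis similar_mat_trans)
    moreover have "U' $$ (i, j) = 0" if "i < Suc a" "j \<le> i" for i j
      using that r12 IH(2,5) by (cases i; cases j) (auto simp: U'_def)
    moreover have "Suc m = Suc a + b" "U' \<in> carrier_mat (Suc a) (Suc a)"
      using IH(1) four_block_carrier_mat[OF zero_carrier_mat[of 1 1] IH(2)] by (simp_all add: U'_def)
    ultimately show ?thesis using IH(3,6) by blast
  qed
qed

section \<open>Conclusion\<close>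

lemma trace_mat_diag:
  fixes U B :: "'a::field mat"
  assumes "U \<in> carrier_mat a a" "B \<in> carrier_mat b b"
  shows "trace_mat (four_block_mat U (0\<^sub>m a b) (0\<^sub>m b a) B) = trace_mat U + trace_mat B"
proof -
  have split: "(\<Sum>i<a + c. f i) = (\<Sum>i<a. f i) + (\<Sum>i<c. f (a + i))" for f :: "nat \<Rightarrow> 'a" and c
    by (induction c) (simp_all add: add.assoc)
  show ?thesis using assms by (simp add: trace_mat_def split)
qed

theorem theorem1p4:
  fixes A :: "'a::field mat" and n :: nat
  assumes "CHAR('a) = 2"
    and "n > 0"
    and "A \<in> carrier_mat n n"
    and "trace_mat A \<in> {0, 1}"
  shows "\<exists>P \<in> carrier_mat (2 * n) (2 * n). \<exists>Q \<in> carrier_mat (2 * n) (2 * n).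
           \<exists>R \<in> carrier_mat (2 * n) (2 * n).
             idempotent_mat P \<and> idempotent_mat Q \<and> idempotent_mat R \<and>
             diag_block_mat [A, 0\<^sub>m n n] = P + Q + R"
proof -
  obtain a b U B where n: "n = a + b" and UB: "U \<in> carrier_mat a a" "B \<in> carrier_mat b b"
    and sim: "similar_mat A (four_block_mat U (0\<^sub>m a b) (0\<^sub>m b a) B)"
    and upper: "\<And>i j. i < a \<Longrightarrow> j \<le> i \<Longrightarrow> U $$ (i, j) = 0" and det: "det B \<noteq> 0"
    using fitting_decomposition[OF assms(3)] by blast
  let ?D = "four_block_mat U (0\<^sub>m a b) (0\<^sub>m b a) B"
  let ?P = "four_block_mat B (0\<^sub>m b b) (0\<^sub>m b b) (0\<^sub>m b b)"
  let ?Z = "four_block_mat ?P (0\<^sub>m (b + b) a) (0\<^sub>m a (b + b)) (0\<^sub>m a a)"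
  have B0: "?P \<in> carrier_mat (b + b) (b + b)" using UB(2) by simp
  have "trace_mat U = 0" using UB(1) upper by (simp add: trace_mat_def)
  then have "trace_mat B \<in> {0, 1}"
    using assms(4) trace_mat_similar[OF sim] trace_mat_diag[OF UB] by simp
  then have "sum_of_three_idempotents (b + b) ?P"
    using sum_of_three_idempotents_pad_invertible[OF assms(1) UB(2) det] by simp
  then have "sum_of_three_idempotents (b + b + a) ?Z"
    by (rule sum_of_three_idempotents_diag[OF B0 zero_carrier_mat _ sum_of_three_idempotents_zero])
  then have "sum_of_three_idempotents (a + (b + b + a))
      (four_block_mat U (0\<^sub>m a (b + b + a)) (0\<^sub>m (b + b + a) a) ?Z)"
    using sum_of_three_idempotents_strictly_upper[OF assms(1) UB(1) upper]
    by (rule sum_of_three_idempotents_diag[OF UB(1) four_block_carrier_mat[OF B0 zero_carrier_mat], rotated])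
  \<comment> \<open>\<open>b\<close> of the \<open>n = a + b\<close> zeros serve as pads for \<open>B\<close>, the others are split off\<close>
  moreover have "four_block_mat U (0\<^sub>m a (b + b + a)) (0\<^sub>m (b + b + a) a) ?Z =
      four_block_mat ?D (0\<^sub>m n n) (0\<^sub>m n n) (0\<^sub>m n n)"
    using UB n by (intro eq_matI) auto
  moreover have "a + (b + b + a) = 2 * n" using n by simp
  moreover have "similar_mat (four_block_mat A (0\<^sub>m n n) (0\<^sub>m n n) (0\<^sub>m n n))
      (four_block_mat ?D (0\<^sub>m n n) (0\<^sub>m n n) (0\<^sub>m n n))"
    using sim assms(3) by (intro similar_mat_four_block_0_0 similar_mat_refl) auto
  moreover have "four_block_mat A (0\<^sub>m n n) (0\<^sub>m n n) (0\<^sub>m n n) \<in> carrier_mat (2 * n) (2 * n)"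
    using assms(3) by (simp add: mult_2)
  ultimately have "sum_of_three_idempotents (2 * n) (four_block_mat A (0\<^sub>m n n) (0\<^sub>m n n) (0\<^sub>m n n))"
    using sum_of_three_idempotents_similar by metis
  moreover have "diag_block_mat [A, 0\<^sub>m n n] = four_block_mat A (0\<^sub>m n n) (0\<^sub>m n n) (0\<^sub>m n n)"
    using assms(3) by (simp add: Let_def)
  ultimately show ?thesis by (simp only: sum_of_three_idempotents_def)
qed

end
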